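(* Let $n\ge 2$, let $X$ be a compact metric space and let $\langle f,h\rangle$ be a representation of $BS(1,n)$ in $\mathrm{Homeo}(X)$, i.e. $f,h\in\mathrm{Homeo}(X)$ with $h\circ f\circ h^{-1}=f^n$. (a) If $\mathrm{fix}(f)$ is non-empty, then: (1) If $x_0\in\mathrm{fix}(f)$, then $\alpha_h(x_0)$ is contained in $\mathrm{fix}(f)$. (2) There exists a $BS$-minimal set included in $\mathrm{fix}(f)$. Moreover, this $BS$-minimal set coincides with an $h$-minimal set in $\mathrm{fix}(f)$. (3) If $\mathrm{fix}(f)$ is finite, then the action of $\langle f,h\rangle$ admits a finite orbit. (4) If $\mathcal M$ is a $BS$-minimal set satisfying $\mathcal M\cap\mathrm{fix}(f)\ne\emptyset$, then $\mathcal M\subset\mathrm{fix}(f)$. (b) If the set $\mathrm{per}(f)$ of periodic points of $f$ is non-empty, then there exist a positive integer $N$ and a $BS$-minimal set $M$ such that $M\subset\mathrm{fix}(f^N)$.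
   Context: $BS(1,n)=\langle a,b\mid aba^{-1}=b^n\rangle$; in $\langle f,h\rangle$, $b$ acts by $f$ and $a$ by $h$ (the representation need not be faithful). $\mathrm{fix}(g)$ is the set of fixed points of $g$. $\alpha_h(x)$ is the set of accumulation points of $h^{-j}(x)$ as $j\to+\infty$. A minimal set of an action of a group $G$ on a compact metric space $X$ is a non-empty closed $G$-invariant subset $M\subset X$ such that any closed $G$-invariant $K\subset M$ satisfies $K=M$ or $K=\emptyset$. A $BS$-minimal set is a minimal set of the action of the group generated by $f$ and $h$; an $h$-minimal set is a minimal set of the action of the group generated by $h$. *)

theory Defs
  imports "HOL-Analysis.Analysis" "HOL-Algebra.Group_Action" "HOL-Algebra.Generated_Groups"
begin

text \<open>
  Compact metric spaces are rendered as compact subsets \<open>X\<close> of a type of class \<open>metric_space\<close>.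
  As in \<^const>\<open>BijGroup\<close>, self-maps of \<open>X\<close> are extensional (\<^const>\<open>undefined\<close> off \<open>X\<close>), so
  that each homeomorphism of \<open>X\<close> is represented by exactly one function.
\<close>

definition homeo_group :: "'a::topological_space set \<Rightarrow> ('a \<Rightarrow> 'a) monoid" where
  "homeo_group X =
     BijGroup X \<lparr>carrier := {f \<in> extensional X. \<exists>g. homeomorphism X X f g}\<rparr>"

text \<open>The group \<open>\<langle>S\<rangle>\<close> of homeomorphisms of \<open>X\<close>; it acts on \<open>X\<close> by \<open>\<lambda>g. g\<close>.\<close>

abbreviation homeo_gen :: "'a::topological_space set \<Rightarrow> ('a \<Rightarrow> 'a) set \<Rightarrow> ('a \<Rightarrow> 'a) monoid" where
  "homeo_gen X S \<equiv> subgroup_generated (homeo_group X) S"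

definition fix_points :: "'a set \<Rightarrow> ('a \<Rightarrow> 'a) \<Rightarrow> 'a set" where
  "fix_points X g = {x \<in> X. g x = x}"

definition per_points :: "'a::topological_space set \<Rightarrow> ('a \<Rightarrow> 'a) \<Rightarrow> 'a set" where
  "per_points X g = {x \<in> X. \<exists>k::nat. k > 0 \<and> x \<in> fix_points X (g [^]\<^bsub>homeo_group X\<^esub> k)}"

text \<open>
  Accumulation points are those of the sequence \<open>h\<^sup>-\<^sup>j(x)\<close>, not of its range: if \<open>x\<close> has
  a finite \<open>h\<close>-orbit, then \<open>alpha_limit X h x\<close> is that orbit rather than empty.
\<close>

definition alpha_limit :: "'a::topological_space set \<Rightarrow> ('a \<Rightarrow> 'a) \<Rightarrow> 'a \<Rightarrow> 'a set" where
  "alpha_limit X h x =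
     {y \<in> X. \<exists>r::nat \<Rightarrow> nat. strict_mono r \<and>
        (\<lambda>i. (h [^]\<^bsub>homeo_group X\<^esub> (- int (r i))) x) \<longlonglongrightarrow> y}"

definition invariant_under :: "('g, 'm) monoid_scheme \<Rightarrow> ('g \<Rightarrow> 'a \<Rightarrow> 'a) \<Rightarrow> 'a set \<Rightarrow> bool" where
  "invariant_under G \<phi> K \<longleftrightarrow> (\<forall>g \<in> carrier G. \<phi> g ` K \<subseteq> K)"

definition minimal_set ::
  "('g, 'm) monoid_scheme \<Rightarrow> 'a::topological_space set \<Rightarrow> ('g \<Rightarrow> 'a \<Rightarrow> 'a) \<Rightarrow> 'a set \<Rightarrow> bool" where
  "minimal_set G X \<phi> M \<longleftrightarrow>
     M \<noteq> {} \<and> closedin (top_of_set X) M \<and> invariant_under G \<phi> M \<and>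
     (\<forall>K. K \<subseteq> M \<and> closedin (top_of_set X) K \<and> invariant_under G \<phi> K \<longrightarrow> K = M \<or> K = {})"

abbreviation homeo_minimal_set :: "'a::topological_space set \<Rightarrow> ('a \<Rightarrow> 'a) set \<Rightarrow> 'a set \<Rightarrow> bool" where
  "homeo_minimal_set X S M \<equiv> minimal_set (homeo_gen X S) X (\<lambda>g. g) M"

lemma homeomorphism_Bij:
  assumes "f \<in> extensional X" "homeomorphism X X f g"
  shows "f \<in> Bij X"
proof -
  have "bij_betw f X X"
    using assms(2) unfolding homeomorphism_def by (intro bij_betw_byWitness[where f' = g]) auto
  with assms(1) show ?thesis
    by (simp add: Bij_def)
qed

lemma subgroup_homeo: "subgroup (carrier (homeo_group X)) (BijGroup X)"
proof (rule group.subgroupI[OF group_BijGroup])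
  show "carrier (homeo_group X) \<subseteq> carrier (BijGroup X)"
    by (auto simp: homeo_group_def BijGroup_def intro: homeomorphism_Bij)
next
  have "homeomorphism X X (\<lambda>x\<in>X. x) (\<lambda>x. x)"
    by (rule homeomorphism_cong[OF homeomorphism_ident]) auto
  then show "carrier (homeo_group X) \<noteq> {}"
    by (simp add: homeo_group_def) (metis restrict_extensional)
next
  fix f assume "f \<in> carrier (homeo_group X)"
  then obtain g where f: "f \<in> extensional X" "homeomorphism X X f g"
    by (auto simp: homeo_group_def)
  have "f \<in> Bij X" using f by (rule homeomorphism_Bij)
  have g: "inv_into X f x = g x" if "x \<in> X" for x
  proof (rule inv_into_f_eq)
    show "inj_on f X" using \<open>f \<in> Bij X\<close> by (simp add: Bij_def bij_betw_def)
    show "g x \<in> X" "f (g x) = x" using f(2) that by (auto simp: homeomorphism_def)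
  qed
  have "homeomorphism X X (\<lambda>x\<in>X. inv_into X f x) f"
    by (rule homeomorphism_cong[OF homeomorphism_symD[OF f(2)]]) (auto simp: g)
  then show "inv\<^bsub>BijGroup X\<^esub> f \<in> carrier (homeo_group X)"
    by (auto simp: inv_BijGroup[OF \<open>f \<in> Bij X\<close>] homeo_group_def)
next
  fix f1 f2 assume "f1 \<in> carrier (homeo_group X)" "f2 \<in> carrier (homeo_group X)"
  then obtain g1 g2 where f: "f1 \<in> extensional X" "homeomorphism X X f1 g1"
      "f2 \<in> extensional X" "homeomorphism X X f2 g2"
    by (auto simp: homeo_group_def)
  have B: "f1 \<in> Bij X" "f2 \<in> Bij X" using f homeomorphism_Bij by blast+
  have "homeomorphism X X (compose X f1 f2) (g2 \<circ> g1)"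
    by (rule homeomorphism_cong[OF homeomorphism_compose[OF f(4) f(2)]]) (auto simp: compose_def)
  then show "f1 \<otimes>\<^bsub>BijGroup X\<^esub> f2 \<in> carrier (homeo_group X)"
    using B by (auto simp: BijGroup_def homeo_group_def)
qed

lemma group_homeo_group: "group (homeo_group X)"
  using group.subgroup_imp_group[OF group_BijGroup subgroup_homeo[of X]]
  by (simp add: homeo_group_def)

lemma homeo_group_mult_apply:
  assumes "f \<in> carrier (homeo_group X)" "g \<in> carrier (homeo_group X)" "x \<in> X"
  shows "(f \<otimes>\<^bsub>homeo_group X\<^esub> g) x = f (g x)"
  using assms by (auto simp: homeo_group_def BijGroup_def compose_def dest: homeomorphism_Bij)

lemma homeo_group_pow_apply:
  assumes f: "f \<in> carrier (homeo_group X)" and x: "x \<in> X"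
  shows "(f [^]\<^bsub>homeo_group X\<^esub> (k::nat)) x = (f ^^ k) x"
  using x
proof (induction k arbitrary: x)
  case 0
  then show ?case by (simp add: homeo_group_def BijGroup_def nat_pow_def)
next
  case (Suc k)
  interpret group "homeo_group X" by (rule group_homeo_group)
  have "f x \<in> X" using f Suc.prems by (auto simp: homeo_group_def homeomorphism_def)
  then show ?case
    using f Suc by (simp add: homeo_group_mult_apply funpow_swap1)
qed

lemma group_action_homeo_gen: "group_action (homeo_gen X S) X (\<lambda>g. g)"
proof -
  interpret H: group "homeo_group X" by (rule group_homeo_group)
  have sub: "carrier (homeo_gen X S) \<subseteq> carrier (homeo_group X)"
    by (rule H.carrier_subgroup_generated_subset)
  have "(\<lambda>g. g) \<in> hom (homeo_gen X S) (BijGroup X)"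
    using sub subgroup.subset[OF subgroup_homeo[of X]]
    by (auto simp: hom_def subgroup_generated_def homeo_group_def)
  then show ?thesis
    by (simp add: group_action_def group_hom_def group_hom_axioms_def group_BijGroup)
qed

end

theory Submission
  imports Defs
begin

text \<open>
  Write \<open>h\<^sup>-\<close> for the inverse of \<open>h\<close>. The relation \<open>h f h\<^sup>- = f\<^sup>n\<close>, read as
  \<open>f h\<^sup>- = h\<^sup>- f\<^sup>n\<close>, says that \<open>h\<^sup>-\<close> maps the closed set \<open>Fix(f\<^sup>N)\<close> into itself for every \<open>N\<close>
  (\<open>inv_h_fix_points\<close>); \<open>h\<close> itself may fail to do so. Accumulation points of backward \<open>h\<close>-orbits of
  fixed points of \<open>f\<close> are therefore fixed by \<open>f\<close>.

  Everything else follows from one existence statement (\<open>minimal_set_exists\<close>): a non-empty closed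
  \<open>C \<subseteq> Fix(f\<^sup>N)\<close>, \<open>N > 0\<close>, that is mapped into itself by \<open>f\<close> and \<open>h\<^sup>-\<close> contains a
  \<open>BS\<close>-minimal set. By Zorn's lemma choose \<open>M \<subseteq> C\<close> minimal among the non-empty compact sets mapped
  into themselves by the two maps \<open>f\<close> and \<open>h\<^sup>-\<close>. The image \<open>h\<^sup>-(M) \<subseteq> M\<close> is again such a set,
  because \<open>f h\<^sup>-(M) = h\<^sup>- f\<^sup>n(M) \<subseteq> h\<^sup>-(M)\<close>; hence \<open>h\<^sup>-(M) = M\<close> and \<open>M\<close> is invariant
  under \<open>h\<close>. It is invariant under the inverse of \<open>f\<close> because that map agrees with \<open>f\<^sup>N\<^sup>-\<^sup>1\<close> on
  \<open>M\<close>. So forward invariance under the two maps upgrades to invariance under the whole group.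

  Taking \<open>C = Fix(f)\<close> gives a \<open>BS\<close>-minimal set inside \<open>Fix(f)\<close>; since \<open>f\<close> acts trivially there,
  \<open>BS\<close>-invariance and \<open>h\<close>-invariance of its subsets agree, so it is also \<open>h\<close>-minimal
  (\<open>minimal_in_fix_points\<close>). If \<open>Fix(f)\<close> is finite, this minimal set contains a finite orbit. If a
  \<open>BS\<close>-minimal set \<open>M\<close> meets \<open>Fix(f)\<close>, take \<open>C = M \<inter> Fix(f)\<close>: the minimal set found there lies
  in \<open>M\<close>, hence equals \<open>M\<close>. If \<open>f\<close> has a periodic point of period \<open>N\<close>, take \<open>C = Fix(f\<^sup>N)\<close>.
\<close>

section \<open>Minimal forward invariant compact sets\<close>

text \<open>
  Zorn's lemma for reverse inclusion: the intersection of a chain of non-empty compact sets is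
  non-empty because every finite subfamily has a least member. Only forward invariance is asked
  for, because \<open>h\<^sup>-\<close> need not map \<open>Fix(f\<^sup>N)\<close> onto itself.
\<close>

lemma minimal_forward_invariant_compact:
  fixes C :: "'a::t2_space set"
  assumes C: "compact C" "C \<noteq> {}" "\<forall>g\<in>T. g ` C \<subseteq> C"
  obtains M where "compact M" "M \<noteq> {}" "M \<subseteq> C" "\<forall>g\<in>T. g ` M \<subseteq> M"
    "\<And>K. \<lbrakk>compact K; K \<noteq> {}; K \<subseteq> M; \<forall>g\<in>T. g ` K \<subseteq> K\<rbrakk> \<Longrightarrow> K = M"
proof -
  define A where "A = {K. compact K \<and> K \<noteq> {} \<and> K \<subseteq> C \<and> (\<forall>g\<in>T. g ` K \<subseteq> K)}"
  have "\<exists>M\<in>A. \<forall>K\<in>A. K \<subseteq> M \<longrightarrow> K = M"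
  proof (rule predicate_Zorn[where P = "\<lambda>K L. L \<subseteq> K"])
    show "partial_order_on A (relation_of (\<lambda>K L. L \<subseteq> K) A)"
      by (rule partial_order_on_relation_ofI) auto
  next
    fix F assume F: "F \<in> Chains (relation_of (\<lambda>K L. L \<subseteq> K) A)"
    show "\<exists>u\<in>A. \<forall>a\<in>F. u \<subseteq> a"
    proof (cases "F = {}")
      case True
      moreover have "C \<in> A" using C by (simp add: A_def)
      ultimately show ?thesis by blast
    next
      case False
      have FA: "F \<subseteq> A"
        using F by (auto simp: Chains_def relation_of_def)
      have lower: "\<Inter>F' \<in> F'" if "finite F'" "F' \<noteq> {}" "F' \<subseteq> F" for F'
        using that
      proof (induction F' rule: finite_ne_induct)
        case (insert S F')
        have "S \<in> F" "\<Inter>F' \<in> F"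
          using insert by blast+
        then have "S \<subseteq> \<Inter>F' \<or> \<Inter>F' \<subseteq> S"
          using F unfolding Chains_def relation_of_def by blast
        then have "\<Inter>(insert S F') = S \<or> \<Inter>(insert S F') = \<Inter>F'"
          unfolding Inter_insert by blast
        then show ?case using insert by auto
      qed simp
      have "C \<inter> \<Inter>F \<noteq> {}"
      proof (rule compact_imp_fip[OF C(1)])
        show "closed S" if "S \<in> F" for S
          using that FA by (auto simp: A_def intro: compact_imp_closed)
        show "C \<inter> \<Inter>F' \<noteq> {}" if F': "finite F'" "F' \<subseteq> F" for F'
        proof (cases "F' = {}")
          case True
          then show ?thesis using C(2) by simp
        next
          case False
          then have "\<Inter>F' \<in> A" using lower[OF F'(1) False F'(2)] F'(2) FA by blast
          then show ?thesis by (auto simp: A_def)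
        qed
      qed
      then have "\<Inter>F \<noteq> {}" by blast
      moreover have "compact (\<Inter>F)"
      proof -
        have "closed (\<Inter>F)"
          using FA by (intro closed_Inter) (auto simp: A_def intro: compact_imp_closed)
        then have "compact (C \<inter> \<Inter>F)"
          using C(1) by (rule compact_Int_closed[rotated])
        moreover have "C \<inter> \<Inter>F = \<Inter>F"
          using FA False by (auto simp: A_def)
        ultimately show ?thesis by simp
      qed
      moreover have "\<Inter>F \<subseteq> C"
        using FA False unfolding A_def by blast
      moreover have "g ` \<Inter>F \<subseteq> \<Inter>F" if "g \<in> T" for g
      proof (rule image_subsetI, rule InterI)
        fix x S assume "x \<in> \<Inter>F" "S \<in> F"
        then have "x \<in> S" "g ` S \<subseteq> S"
          using FA \<open>g \<in> T\<close> unfolding A_def by blast+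
        then show "g x \<in> S" by blast
      qed
      ultimately have "\<Inter>F \<in> A"
        by (simp add: A_def)
      then show ?thesis by blast
    qed
  qed
  then obtain M where M: "M \<in> A" "\<And>K. K \<in> A \<Longrightarrow> K \<subseteq> M \<Longrightarrow> K = M"
    by blast
  show thesis
  proof (rule that[of M])
    fix K assume "compact K" "K \<noteq> {}" "K \<subseteq> M" "\<forall>g\<in>T. g ` K \<subseteq> K"
    then show "K = M"
      using M(1) by (intro M(2)) (auto simp: A_def)
  qed (use M(1) in \<open>auto simp: A_def\<close>)
qed

section \<open>Homeomorphism groups\<close>

lemma homeo_group_continuous:
  "g \<in> carrier (homeo_group X) \<Longrightarrow> continuous_on X g"
  by (auto simp: homeo_group_def homeomorphism_def)

lemma homeo_group_in:
  "\<lbrakk>g \<in> carrier (homeo_group X); x \<in> X\<rbrakk> \<Longrightarrow> g x \<in> X"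
  by (auto simp: homeo_group_def homeomorphism_def)

lemma homeo_group_one_apply: "x \<in> X \<Longrightarrow> \<one>\<^bsub>homeo_group X\<^esub> x = x"
  by (simp add: homeo_group_def BijGroup_def)

lemma homeo_group_inv_closed:
  "g \<in> carrier (homeo_group X) \<Longrightarrow> inv\<^bsub>homeo_group X\<^esub> g \<in> carrier (homeo_group X)"
  by (rule group.inv_closed[OF group_homeo_group])

lemma homeo_group_inv_apply:
  assumes "g \<in> carrier (homeo_group X)" "x \<in> X"
  shows "(inv\<^bsub>homeo_group X\<^esub> g) (g x) = x" "g ((inv\<^bsub>homeo_group X\<^esub> g) x) = x"
proof -
  interpret group "homeo_group X" by (rule group_homeo_group)
  show "(inv\<^bsub>homeo_group X\<^esub> g) (g x) = x"
    using assms homeo_group_mult_apply[of "inv\<^bsub>homeo_group X\<^esub> g" X g x]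
    by (simp add: homeo_group_one_apply)
  show "g ((inv\<^bsub>homeo_group X\<^esub> g) x) = x"
    using assms homeo_group_mult_apply[of g X "inv\<^bsub>homeo_group X\<^esub> g" x]
    by (simp add: homeo_group_one_apply)
qed

lemma homeo_group_pow_closed:
  "g \<in> carrier (homeo_group X) \<Longrightarrow> g [^]\<^bsub>homeo_group X\<^esub> (k::nat) \<in> carrier (homeo_group X)"
  by (rule monoid.nat_pow_closed[OF group.is_monoid[OF group_homeo_group]])

lemma homeo_group_neg_pow_apply:
  assumes "g \<in> carrier (homeo_group X)" "x \<in> X"
  shows "(g [^]\<^bsub>homeo_group X\<^esub> (- int k)) x = ((inv\<^bsub>homeo_group X\<^esub> g) ^^ k) x"
proof -
  interpret group "homeo_group X" by (rule group_homeo_group)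
  have "g [^]\<^bsub>homeo_group X\<^esub> (- int k) = (inv\<^bsub>homeo_group X\<^esub> g) [^]\<^bsub>homeo_group X\<^esub> k"
    using assms(1) by (simp add: int_pow_neg_int nat_pow_inv)
  then show ?thesis
    using assms by (simp add: homeo_group_pow_apply)
qed

lemma fix_points_compact:
  fixes X :: "'a::t2_space set"
  assumes "compact X" "g \<in> carrier (homeo_group X)"
  shows "compact (fix_points X g)"
proof -
  (* The fixed points are the preimage of the closed diagonal under the graph map. *)
  have "continuous_on X (\<lambda>x. (x, g x))"
    using homeo_group_continuous[OF assms(2)] by (intro continuous_intros)
  then have "closedin (top_of_set X) (X \<inter> (\<lambda>x. (x, g x)) -` {y. \<exists>x. y = (x, x)})"
    using closed_diagonal by (rule continuous_closedin_preimage)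
  moreover have "X \<inter> (\<lambda>x. (x, g x)) -` {y. \<exists>x. y = (x, x)} = fix_points X g"
    by (auto simp: fix_points_def)
  ultimately show ?thesis
    using closedin_compact[OF assms(1)] by simp
qed

text \<open>Inverses must be listed: a closed set can be mapped into, but not onto, itself.\<close>

lemma invariant_under_homeo_gen_iff:
  assumes S: "S \<subseteq> carrier (homeo_group X)" and K: "K \<subseteq> X"
  shows "invariant_under (homeo_gen X S) (\<lambda>g. g) K \<longleftrightarrow>
    (\<forall>s\<in>S. s ` K \<subseteq> K \<and> (inv\<^bsub>homeo_group X\<^esub> s) ` K \<subseteq> K)"
proof -
  have carr: "carrier (homeo_gen X S) = generate (homeo_group X) S"
    using S by (simp add: carrier_subgroup_generated Int_absorb1)
  have gen: "g \<in> carrier (homeo_group X) \<and> g ` K \<subseteq> K"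
    if "g \<in> generate (homeo_group X) S"
      and inv: "\<forall>s\<in>S. s ` K \<subseteq> K \<and> (inv\<^bsub>homeo_group X\<^esub> s) ` K \<subseteq> K" for g
    using that(1)
  proof (induction rule: generate.induct)
    case one
    have "\<one>\<^bsub>homeo_group X\<^esub> x = x" if "x \<in> K" for x
      using that K by (intro homeo_group_one_apply) blast
    then show ?case
      by (simp add: monoid.one_closed[OF group.is_monoid[OF group_homeo_group]])
  next
    case (incl s)
    then show ?case using S inv by blast
  next
    case (inv s)
    then show ?case using S that(2) homeo_group_inv_closed by blast
  next
    case (eng g1 g2)
    have "(g1 \<otimes>\<^bsub>homeo_group X\<^esub> g2) x \<in> K" if "x \<in> K" for x
    proof -
      have "(g1 \<otimes>\<^bsub>homeo_group X\<^esub> g2) x = g1 (g2 x)"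
        using eng.IH that K by (intro homeo_group_mult_apply) blast+
      then show ?thesis using eng.IH that by auto
    qed
    moreover have "g1 \<otimes>\<^bsub>homeo_group X\<^esub> g2 \<in> carrier (homeo_group X)"
      using eng.IH monoid.m_closed[OF group.is_monoid[OF group_homeo_group]] by blast
    ultimately show ?case by blast
  qed
  show ?thesis
    unfolding invariant_under_def carr
  proof
    assume "\<forall>g\<in>generate (homeo_group X) S. g ` K \<subseteq> K"
    then show "\<forall>s\<in>S. s ` K \<subseteq> K \<and> (inv\<^bsub>homeo_group X\<^esub> s) ` K \<subseteq> K"
      using generate.incl generate.inv by metis
  next
    assume "\<forall>s\<in>S. s ` K \<subseteq> K \<and> (inv\<^bsub>homeo_group X\<^esub> s) ` K \<subseteq> K"
    then show "\<forall>g\<in>generate (homeo_group X) S. g ` K \<subseteq> K"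
      using gen by blast
  qed
qed

section \<open>Actions of the Baumslag--Solitar group\<close>

locale BS_action =
  fixes X :: "'a::metric_space set" and f h :: "'a \<Rightarrow> 'a" and n :: nat
  assumes compact_X: "compact X"
    and f: "f \<in> carrier (homeo_group X)" and h: "h \<in> carrier (homeo_group X)"
    and rel: "h \<otimes>\<^bsub>homeo_group X\<^esub> f \<otimes>\<^bsub>homeo_group X\<^esub> inv\<^bsub>homeo_group X\<^esub> h
      = f [^]\<^bsub>homeo_group X\<^esub> n"
begin

abbreviation h_inv :: "'a \<Rightarrow> 'a" where
  "h_inv \<equiv> inv\<^bsub>homeo_group X\<^esub> h"

abbreviation f_inv :: "'a \<Rightarrow> 'a" where
  "f_inv \<equiv> inv\<^bsub>homeo_group X\<^esub> f"

lemma h_inv: "h_inv \<in> carrier (homeo_group X)"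
  using h by (rule homeo_group_inv_closed)

lemma funpow_in:
  assumes "x \<in> X" shows "(f ^^ k) x \<in> X"
  using homeo_group_in[OF homeo_group_pow_closed[OF f] assms, of k]
  by (simp add: homeo_group_pow_apply[OF f assms])

lemma fix_points_pow_iff:
  "x \<in> fix_points X (f [^]\<^bsub>homeo_group X\<^esub> k) \<longleftrightarrow> x \<in> X \<and> (f ^^ k) x = x"
  by (auto simp: fix_points_def homeo_group_pow_apply[OF f])

lemma fix_points_pow_1: "fix_points X (f [^]\<^bsub>homeo_group X\<^esub> (1::nat)) = fix_points X f"
  by (simp add: monoid.nat_pow_Suc monoid.nat_pow_0 group.is_monoid[OF group_homeo_group]
      monoid.l_one[OF group.is_monoid[OF group_homeo_group] f])

lemma f_h_inv:
  assumes x: "x \<in> X"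
  shows "f (h_inv x) = h_inv ((f ^^ n) x)"
proof -
  have k: "h_inv x \<in> X" using homeo_group_in[OF h_inv x] .
  have hf: "h \<otimes>\<^bsub>homeo_group X\<^esub> f \<in> carrier (homeo_group X)"
    using f h by (simp add: monoid.m_closed[OF group.is_monoid[OF group_homeo_group]])
  have "(f ^^ n) x = h (f (h_inv x))"
    using homeo_group_pow_apply[OF f x, of n] unfolding rel[symmetric]
    by (simp add: homeo_group_mult_apply[OF hf h_inv x] homeo_group_mult_apply[OF h f k])
  then show ?thesis
    using homeo_group_inv_apply(1)[OF h homeo_group_in[OF f k]] by simp
qed

lemma funpow_h_inv:
  assumes x: "x \<in> X"
  shows "(f ^^ k) (h_inv x) = h_inv ((f ^^ (n * k)) x)"
proof (induction k)
  case (Suc k)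
  then show ?case
    using f_h_inv[OF funpow_in[OF x, of "n * k"]] by (simp add: funpow_add)
qed simp

text \<open>
  If \<open>f\<^sup>N\<close> fixes \<open>x\<close>, so does its \<open>n\<close>-th power, and moving \<open>f\<^sup>N\<close> past \<open>h\<^sup>-\<close> produces exactly that
  power. The map \<open>h\<close> does not have this property in general: it carries \<open>Fix(f)\<close> onto
  \<open>Fix(f\<^sup>n)\<close>, which may be larger.
\<close>

lemma inv_h_fix_points:
  assumes "x \<in> fix_points X (f [^]\<^bsub>homeo_group X\<^esub> (N::nat))"
  shows "h_inv x \<in> fix_points X (f [^]\<^bsub>homeo_group X\<^esub> N)"
proof -
  have x: "x \<in> X" "(f ^^ N) x = x"
    using assms by (auto simp: fix_points_pow_iff)
  have "(f ^^ (n * N)) x = ((f ^^ N) ^^ n) x"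
    by (simp add: funpow_mult mult.commute)
  also have "\<dots> = x"
    using x(2) by (induction n) auto
  finally show ?thesis
    using x homeo_group_in[OF h_inv] by (simp add: fix_points_pow_iff funpow_h_inv)
qed

lemma alpha_limit_fix_points:
  assumes x0: "x0 \<in> fix_points X f"
  shows "alpha_limit X h x0 \<subseteq> fix_points X f"
proof
  fix y assume "y \<in> alpha_limit X h x0"
  then obtain r :: "nat \<Rightarrow> nat"
    where lim: "(\<lambda>i. (h [^]\<^bsub>homeo_group X\<^esub> (- int (r i))) x0) \<longlonglongrightarrow> y"
    by (auto simp: alpha_limit_def)
  have x0X: "x0 \<in> X" using x0 by (simp add: fix_points_def)
  have "(h_inv ^^ k) x0 \<in> fix_points X f" for k
    using x0 inv_h_fix_points[where N = 1, unfolded fix_points_pow_1] by (induction k) auto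
  then have "(h [^]\<^bsub>homeo_group X\<^esub> (- int (r i))) x0 \<in> fix_points X f" for i
    by (simp add: homeo_group_neg_pow_apply[OF h x0X])
  moreover have "closed (fix_points X f)"
    using fix_points_compact[OF compact_X f] by (rule compact_imp_closed)
  ultimately show "y \<in> fix_points X f"
    using lim by (meson closed_sequentially)
qed

lemma invariant_BS_iff:
  assumes "K \<subseteq> X"
  shows "invariant_under (homeo_gen X {f, h}) (\<lambda>g. g) K \<longleftrightarrow>
    f ` K \<subseteq> K \<and> f_inv ` K \<subseteq> K \<and> h ` K \<subseteq> K \<and> h_inv ` K \<subseteq> K"
  using invariant_under_homeo_gen_iff[OF _ assms, of "{f, h}"] f h by simp

lemma invariant_h_iff:
  assumes "K \<subseteq> X"
  shows "invariant_under (homeo_gen X {h}) (\<lambda>g. g) K \<longleftrightarrow> h ` K \<subseteq> K \<and> h_inv ` K \<subseteq> K"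
  using invariant_under_homeo_gen_iff[OF _ assms, of "{h}"] h by simp

text \<open>
  The group is generated by \<open>f\<close>, \<open>h\<close> and their inverses, but a set minimal for \<open>f\<close> and \<open>h\<^sup>-\<close>
  alone is already invariant under the other two: under \<open>h\<close> because \<open>h\<^sup>-(M)\<close> competes with \<open>M\<close>, and
  under the inverse of \<open>f\<close> because \<open>f\<close> has finite order on \<open>C\<close>.
\<close>

lemma minimal_set_exists:
  assumes N: "N > 0"
    and C: "compact C" "C \<noteq> {}" "C \<subseteq> fix_points X (f [^]\<^bsub>homeo_group X\<^esub> (N::nat))"
    and fC: "f ` C \<subseteq> C" and hC: "h_inv ` C \<subseteq> C"
  obtains M where "homeo_minimal_set X {f, h} M" "M \<subseteq> C"
proof -
  have CX: "C \<subseteq> X" using C(3) by (auto simp: fix_points_def)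
  have "\<forall>g\<in>{f, h_inv}. g ` C \<subseteq> C" using fC hC by simp
  from minimal_forward_invariant_compact[OF C(1,2) this]
  obtain M where M: "compact M" "M \<noteq> {}" "M \<subseteq> C" "\<forall>g\<in>{f, h_inv}. g ` M \<subseteq> M"
    and min: "\<And>K. \<lbrakk>compact K; K \<noteq> {}; K \<subseteq> M; \<forall>g\<in>{f, h_inv}. g ` K \<subseteq> K\<rbrakk> \<Longrightarrow> K = M"
    by metis
  have fM: "f ` M \<subseteq> M" and kM: "h_inv ` M \<subseteq> M" using M(4) by auto
  have MX: "M \<subseteq> X" using M(3) CX by blast
  have powM: "(f ^^ k) x \<in> M" if "x \<in> M" for x k
    using that fM by (induction k) auto
  (* The image of M under the inverse of h is itself forward invariant, so minimality applies. *)
  have "h_inv ` M = M"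
  proof (rule min)
    show "compact (h_inv ` M)"
      using M(1) continuous_on_subset[OF homeo_group_continuous[OF h_inv] MX]
      by (rule compact_continuous_image[rotated])
    have "f (h_inv x) \<in> h_inv ` M" if "x \<in> M" for x
      using f_h_inv[of x] powM[OF that] that MX by auto
    then show "\<forall>g\<in>{f, h_inv}. g ` h_inv ` M \<subseteq> h_inv ` M"
      using kM by auto
  qed (use M(2) kM in auto)
  then have "h ` M = h ` h_inv ` M" by simp
  also have "\<dots> = M"
    using homeo_group_inv_apply(2)[OF h] MX by (simp add: image_image subset_iff cong: image_cong_simp)
  finally have hM: "h ` M \<subseteq> M" by simp
  (* As f ^^ N is the identity on M, the inverse of f is f ^^ (N - 1) there. *)
  have "f_inv x \<in> M" if x: "x \<in> M" for x
  proof -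
    have "(f ^^ N) x = x" using x M(3) C(3) by (auto simp: fix_points_pow_iff)
    then have "f ((f ^^ (N - 1)) x) = x"
      using N by (cases N) auto
    then have "f_inv x = (f ^^ (N - 1)) x"
      using homeo_group_inv_apply(1)[OF f funpow_in[of x "N - 1"]] x MX by auto
    then show ?thesis using powM[OF x] by simp
  qed
  then have invM: "invariant_under (homeo_gen X {f, h}) (\<lambda>g. g) M"
    using fM hM kM by (auto simp: invariant_BS_iff[OF MX])
  have "K = M \<or> K = {}"
    if "K \<subseteq> M" "closedin (top_of_set X) K" "invariant_under (homeo_gen X {f, h}) (\<lambda>g. g) K" for K
  proof -
    have "K \<subseteq> X" using that(1) MX by blast
    then show ?thesis
      using min[of K] that by (auto simp: closedin_compact_eq[OF compact_X] invariant_BS_iff)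
  qed
  then have "homeo_minimal_set X {f, h} M"
    unfolding minimal_set_def using M(1,2) MX invM
    by (auto simp: closedin_compact_eq[OF compact_X])
  then show thesis using that M(3) by blast
qed

lemma minimal_set_exists_in_fix_points:
  assumes C: "compact C" "C \<noteq> {}" "C \<subseteq> fix_points X f" and hC: "h_inv ` C \<subseteq> C"
  obtains M where "homeo_minimal_set X {f, h} M" "M \<subseteq> C"
proof -
  have C1: "C \<subseteq> fix_points X (f [^]\<^bsub>homeo_group X\<^esub> (1::nat))"
    unfolding fix_points_pow_1 by (rule C(3))
  have fC: "f ` C \<subseteq> C" using C(3) by (auto simp: fix_points_def)
  show thesis
    by (rule minimal_set_exists[OF zero_less_one C(1,2) C1 fC hC]) (rule that)
qed

text \<open>
  On \<open>Fix(f)\<close> both \<open>f\<close> and its inverse are the identity, so the two groups have the same invariant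
  subsets of \<open>M\<close>.
\<close>

lemma minimal_in_fix_points:
  assumes M: "M \<subseteq> fix_points X f"
  shows "homeo_minimal_set X {f, h} M \<longleftrightarrow> homeo_minimal_set X {h} M"
proof -
  have "invariant_under (homeo_gen X {f, h}) (\<lambda>g. g) K \<longleftrightarrow>
      invariant_under (homeo_gen X {h}) (\<lambda>g. g) K" if KM: "K \<subseteq> M" for K
  proof -
    have KX: "K \<subseteq> X" and fK: "\<And>x. x \<in> K \<Longrightarrow> f x = x"
      using KM M unfolding fix_points_def by blast+
    have "f_inv x = x" if "x \<in> K" for x
      using homeo_group_inv_apply(1)[OF f subsetD[OF KX that]] fK[OF that] by simp
    with fK have "f ` K = K" "f_inv ` K = K"
      by simp_all
    then show ?thesis
      by (simp add: invariant_BS_iff[OF KX] invariant_h_iff[OF KX])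
  qed
  then show ?thesis
    unfolding minimal_set_def by blast
qed

end

theorem theorem4:
  fixes X :: "'a::metric_space set" and f h :: "'a \<Rightarrow> 'a" and n :: nat
  assumes "n \<ge> 2"
    and "compact X"
    and "f \<in> carrier (homeo_group X)" and "h \<in> carrier (homeo_group X)"
    and "h \<otimes>\<^bsub>homeo_group X\<^esub> f \<otimes>\<^bsub>homeo_group X\<^esub> inv\<^bsub>homeo_group X\<^esub> h = f [^]\<^bsub>homeo_group X\<^esub> n"
  shows "(fix_points X f \<noteq> {} \<longrightarrow>
            (\<forall>x0 \<in> fix_points X f. alpha_limit X h x0 \<subseteq> fix_points X f) \<and>
            (\<exists>M. homeo_minimal_set X {f, h} M \<and> M \<subseteq> fix_points X f \<and> homeo_minimal_set X {h} M) \<and>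
            (finite (fix_points X f) \<longrightarrow> (\<exists>x \<in> X. finite (orbit (homeo_gen X {f, h}) (\<lambda>g. g) x))) \<and>
            (\<forall>M. homeo_minimal_set X {f, h} M \<and> M \<inter> fix_points X f \<noteq> {} \<longrightarrow> M \<subseteq> fix_points X f)) \<and>
         (per_points X f \<noteq> {} \<longrightarrow>
            (\<exists>(N::nat) M. N > 0 \<and> homeo_minimal_set X {f, h} M \<and>
               M \<subseteq> fix_points X (f [^]\<^bsub>homeo_group X\<^esub> N)))"
proof -
  interpret BS_action X f h n
    using assms by unfold_locales
  have h_fix: "h_inv ` fix_points X f \<subseteq> fix_points X f"
    using inv_h_fix_points[where N = 1, unfolded fix_points_pow_1] by auto
  have BS_minimal_in_fix: "\<exists>M. homeo_minimal_set X {f, h} M \<and> M \<subseteq> fix_points X f"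
    if "fix_points X f \<noteq> {}"
    using minimal_set_exists_in_fix_points[OF fix_points_compact[OF compact_X f] that] h_fix
    by blast
  have finite_orbit: "\<exists>x\<in>X. finite (orbit (homeo_gen X {f, h}) (\<lambda>g. g) x)"
    if ne: "fix_points X f \<noteq> {}" and fin: "finite (fix_points X f)"
  proof -
    obtain M where M: "homeo_minimal_set X {f, h} M" "M \<subseteq> fix_points X f"
      using BS_minimal_in_fix[OF ne] by blast
    then obtain x where x: "x \<in> M" by (auto simp: minimal_set_def)
    have "orbit (homeo_gen X {f, h}) (\<lambda>g. g) x \<subseteq> M"
      using M(1) x by (auto simp: orbit_def minimal_set_def invariant_under_def)
    then have "finite (orbit (homeo_gen X {f, h}) (\<lambda>g. g) x)"
      using M(2) fin by (meson finite_subset)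
    then show ?thesis
      using x M(2) by (auto simp: fix_points_def)
  qed
  have meets_fix: "M \<subseteq> fix_points X f"
    if M: "homeo_minimal_set X {f, h} M" and ne: "M \<inter> fix_points X f \<noteq> {}" for M
  proof -
    have cM: "compact M" "M \<subseteq> X" and invM: "invariant_under (homeo_gen X {f, h}) (\<lambda>g. g) M"
      using M by (auto simp: minimal_set_def closedin_compact_eq[OF compact_X])
    have "h_inv ` (M \<inter> fix_points X f) \<subseteq> M \<inter> fix_points X f"
      using invM h_fix by (auto simp: invariant_BS_iff[OF cM(2)])
    moreover have "compact (M \<inter> fix_points X f)"
      using cM(1) fix_points_compact[OF compact_X f] by (rule compact_Int)
    ultimately obtain M' where M': "homeo_minimal_set X {f, h} M'" "M' \<subseteq> M \<inter> fix_points X f"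
      using minimal_set_exists_in_fix_points[of "M \<inter> fix_points X f"] ne by blast
    then have "M' = M"
      using M unfolding minimal_set_def by blast
    then show ?thesis using M'(2) by blast
  qed
  have periodic: "\<exists>(N::nat) M. N > 0 \<and> homeo_minimal_set X {f, h} M \<and>
      M \<subseteq> fix_points X (f [^]\<^bsub>homeo_group X\<^esub> N)" if "per_points X f \<noteq> {}"
  proof -
    from that obtain x and N :: nat
      where N: "N > 0" and x: "x \<in> fix_points X (f [^]\<^bsub>homeo_group X\<^esub> N)"
      unfolding per_points_def by blast
    let ?C = "fix_points X (f [^]\<^bsub>homeo_group X\<^esub> N)"
    have "f ` ?C \<subseteq> ?C"
      using homeo_group_in[OF f] by (auto simp: fix_points_pow_iff funpow_swap1[symmetric])
    moreover have "h_inv ` ?C \<subseteq> ?C"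
      using inv_h_fix_points by blast
    moreover have "compact ?C" "?C \<noteq> {}"
      using fix_points_compact[OF compact_X homeo_group_pow_closed[OF f]] x by blast+
    ultimately obtain M where "homeo_minimal_set X {f, h} M" "M \<subseteq> ?C"
      using minimal_set_exists[OF N, of ?C] by blast
    then show ?thesis using N by blast
  qed
  show ?thesis
  proof (intro conjI impI)
    assume ne: "fix_points X f \<noteq> {}"
    show "\<forall>x0\<in>fix_points X f. alpha_limit X h x0 \<subseteq> fix_points X f"
      using alpha_limit_fix_points by blast
    obtain M where "homeo_minimal_set X {f, h} M" "M \<subseteq> fix_points X f"
      using BS_minimal_in_fix[OF ne] by blast
    then show "\<exists>M. homeo_minimal_set X {f, h} M \<and> M \<subseteq> fix_points X f \<and> homeo_minimal_set X {h} M"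
      using minimal_in_fix_points by blast
    show "\<exists>x\<in>X. finite (orbit (homeo_gen X {f, h}) (\<lambda>g. g) x)" if "finite (fix_points X f)"
      using finite_orbit[OF ne that] .
    show "\<forall>M. homeo_minimal_set X {f, h} M \<and> M \<inter> fix_points X f \<noteq> {} \<longrightarrow> M \<subseteq> fix_points X f"
      using meets_fix by blast
  qed (rule periodic)
qed

end
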